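(* A generic compact metric space is a Cantor space: the set of $X\in\mathfrak{M}$ that are homeomorphic to the Cantor set is a residual subset of the Gromov-Hausdorff space $(\mathfrak{M},d_{GH})$.
   Context: $\mathfrak{M}$ denotes the Gromov-Hausdorff space: the set of all nonempty compact metric spaces up to isometry, endowed with the Gromov-Hausdorff distance $d_{GH}(X,Y)=\inf d_H^Z(f(X),g(Y))$, where the infimum is over all metric spaces $Z$ and all isometric injections $f:X\to Z$, $g:Y\to Z$, and $d_H^Z$ is the Hausdorff distance between subsets of $Z$. The metric space $\mathfrak{M}$ is complete, hence a Baire space. A subset is rare if its closure has empty interior, meager if it is a countable union of rare sets, and residual if its complement is meager. "A generic compact metric space has property $P$" means that the set of $X\in\mathfrak{M}$ having $P$ is residual in $\mathfrak{M}$. *)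

theory Defs
  imports "HOL-Analysis.Analysis"
begin

definition isometric_injection :: "'a metric \<Rightarrow> 'b metric \<Rightarrow> ('a \<Rightarrow> 'b) \<Rightarrow> bool" where
  "isometric_injection X Z f \<longleftrightarrow>
     f \<in> mspace X \<rightarrow> mspace Z \<and>
     (\<forall>x\<in>mspace X. \<forall>y\<in>mspace X. mdist Z (f x) (f y) = mdist X x y)"

definition isometric :: "'a metric \<Rightarrow> 'b metric \<Rightarrow> bool" where
  "isometric X Y \<longleftrightarrow> (\<exists>f. isometric_injection X Y f \<and> f ` mspace X = mspace Y)"

definition compact_metric :: "'a metric \<Rightarrow> bool" where
  "compact_metric X \<longleftrightarrow> mspace X \<noteq> {} \<and> compact_space (mtopology_of X)"

(* Real-valued, hence only meaningful for bounded nonempty A and B; it is applied to compact ones. *)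
definition hausdorff_dist :: "'a metric \<Rightarrow> 'a set \<Rightarrow> 'a set \<Rightarrow> real" where
  "hausdorff_dist Z A B =
     max (SUP a\<in>A. INF b\<in>B. mdist Z a b) (SUP b\<in>B. INF a\<in>A. mdist Z a b)"

(* The ambient spaces Z range over the metric spaces carried by sets of reals. This is no
   restriction: replacing Z by the union of the two images, which has at most continuum
   cardinality, does not change the Hausdorff distance; see gh_values_any_ambient below. *)
definition gh_values :: "'a metric \<Rightarrow> 'b metric \<Rightarrow> real set" where
  "gh_values X Y =
     {hausdorff_dist Z (f ` mspace X) (g ` mspace Y) | (Z :: real metric) f g.
        isometric_injection X Z f \<and> isometric_injection Y Z g}"

lemma isometric_injection_inj_on:
  assumes "isometric_injection X Z f"
  shows "inj_on f (mspace X)"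
proof (rule inj_onI)
  fix x y assume xy: "x \<in> mspace X" "y \<in> mspace X" "f x = f y"
  have "f x \<in> mspace Z" using assms xy(1) by (auto simp: isometric_injection_def)
  then have "mdist Z (f x) (f y) = 0" using xy(3) by (metis mdist_zero)
  then have "mdist X x y = 0" using assms xy(1,2) unfolding isometric_injection_def by metis
  then show "x = y" using xy(1,2) by (metis mdist_zero)
qed

lemma isometric_injection_compose:
  assumes "isometric_injection X Y f" "isometric_injection Y Z g"
  shows "isometric_injection X Z (g \<circ> f)"
  using assms by (auto simp: isometric_injection_def Pi_iff)

lemma isometric_refl: "isometric X X"
  unfolding isometric_def by (rule exI[of _ id]) (simp add: isometric_injection_def)

lemma isometric_sym:
  assumes "isometric X Y"
  shows "isometric Y X"
proof -
  obtain f where f: "isometric_injection X Y f" "f ` mspace X = mspace Y"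
    using assms by (auto simp: isometric_def)
  have inj: "inj_on f (mspace X)" by (rule isometric_injection_inj_on[OF f(1)])
  let ?g = "inv_into (mspace X) f"
  have g: "\<And>x. x \<in> mspace X \<Longrightarrow> ?g (f x) = x" "?g ` mspace Y = mspace X"
    using inj f(2)[symmetric] by simp_all
  have "mdist X (?g u) (?g v) = mdist Y u v" if "u \<in> mspace Y" "v \<in> mspace Y" for u v
    using that f g unfolding isometric_injection_def by (metis (no_types, lifting) imageE)
  then have "isometric_injection Y X ?g"
    using g(2) unfolding isometric_injection_def by blast
  then show ?thesis using g(2) unfolding isometric_def by blast
qed

lemma isometric_trans:
  assumes "isometric X Y" "isometric Y Z"
  shows "isometric X Z"
proof -
  obtain f g where "isometric_injection X Y f" "f ` mspace X = mspace Y"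
    "isometric_injection Y Z g" "g ` mspace Y = mspace Z"
    using assms by (auto simp: isometric_def)
  then show ?thesis
    unfolding isometric_def
    by (intro exI[of _ "g \<circ> f"]) (metis image_comp isometric_injection_compose)
qed

lemma isometric_imp_homeomorphic_space:
  assumes "isometric X Y"
  shows "mtopology_of X homeomorphic_space mtopology_of Y"
proof -
  obtain f where f: "isometric_injection X Y f" "f ` mspace X = mspace Y"
    using assms by (auto simp: isometric_def)
  interpret Metric_space12 "mspace X" "mdist X" "mspace Y" "mdist Y"
    by (rule Metric_space12_mspace_mdist)
  have "homeomorphic_map M1.mtopology M2.mtopology f"
    using f by (intro isometry_imp_homeomorphic_map) (auto simp: isometric_injection_def)
  then show ?thesis
    using homeomorphic_map_imp_homeomorphic_space unfolding mtopology_of_def by blast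
qed

lemma isometric_imp_homeomorphic_space_iff:
  assumes "isometric X Y"
  shows "mtopology_of X homeomorphic_space T \<longleftrightarrow> mtopology_of Y homeomorphic_space T"
  using isometric_imp_homeomorphic_space[OF assms] homeomorphic_space_sym homeomorphic_space_trans
  by metis

lemma isometric_injection_isometric_image:
  assumes "isometric X X'" "isometric_injection X Z f"
  obtains f' where "isometric_injection X' Z f'" "f' ` mspace X' = f ` mspace X"
proof -
  obtain h where "isometric_injection X' X h" "h ` mspace X' = mspace X"
    using isometric_sym[OF assms(1)] by (auto simp: isometric_def)
  then show thesis
    using that[of "f \<circ> h"] assms(2) isometric_injection_compose by (metis image_comp)
qed

lemma gh_values_mono:
  assumes "isometric X X'" "isometric Y Y'"
  shows "gh_values X Y \<subseteq> gh_values X' Y'"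
proof
  fix r assume "r \<in> gh_values X Y"
  then obtain Z :: "real metric" and f g where
    r: "r = hausdorff_dist Z (f ` mspace X) (g ` mspace Y)"
    and fg: "isometric_injection X Z f" "isometric_injection Y Z g"
    by (auto simp: gh_values_def)
  obtain f' where "isometric_injection X' Z f'" "f' ` mspace X' = f ` mspace X"
    using isometric_injection_isometric_image[OF assms(1) fg(1)] .
  moreover obtain g' where "isometric_injection Y' Z g'" "g' ` mspace Y' = g ` mspace Y"
    using isometric_injection_isometric_image[OF assms(2) fg(2)] .
  ultimately show "r \<in> gh_values X' Y'"
    using r unfolding gh_values_def by (metis (mono_tags, lifting) mem_Collect_eq)
qed

lemma gh_values_cong:
  assumes "isometric X X'" "isometric Y Y'"
  shows "gh_values X Y = gh_values X' Y'"
  using gh_values_mono assms isometric_sym by (metis subset_antisym)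

(* Isometry classes of nonempty compact metric spaces. The carriers may be taken to be sets of
   reals, since every compact metric space is isometric to such a space: see
   compact_metric_isometric_real below. *)
quotient_type gh_space = "real metric" / partial:
  "\<lambda>X Y. compact_metric X \<and> compact_metric Y \<and> isometric X Y"
proof (rule part_equivpI)
  define X :: "real metric" where "X = submetric euclidean_metric {0}"
  have "compact_metric X"
    by (simp add: X_def compact_metric_def mtopology_of_submetric compact_space_subtopology)
  then show "\<exists>X :: real metric. compact_metric X \<and> compact_metric X \<and> isometric X X"
    using isometric_refl by blast
next
  show "symp (\<lambda>X Y :: real metric. compact_metric X \<and> compact_metric Y \<and> isometric X Y)"
    unfolding symp_def using isometric_sym by blast
  show "transp (\<lambda>X Y :: real metric. compact_metric X \<and> compact_metric Y \<and> isometric X Y)"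
    unfolding transp_def using isometric_trans by blast
qed

lift_definition gh_dist :: "gh_space \<Rightarrow> gh_space \<Rightarrow> real" is
  "\<lambda>X Y. Inf (gh_values X Y)"
  by (rule arg_cong[where f = Inf], rule gh_values_cong) blast+

lift_definition gh_homeomorphic :: "gh_space \<Rightarrow> 'b topology \<Rightarrow> bool" is
  "\<lambda>X T. mtopology_of X homeomorphic_space T"
  by (elim conjE, rule ext) (rule isometric_imp_homeomorphic_space_iff)

definition gh_topology :: "gh_space topology" where
  "gh_topology = Metric_space.mtopology UNIV gh_dist"

definition rare_in :: "'a topology \<Rightarrow> 'a set \<Rightarrow> bool" where
  "rare_in T S \<longleftrightarrow> S \<subseteq> topspace T \<and> T interior_of (T closure_of S) = {}"

definition meager_in :: "'a topology \<Rightarrow> 'a set \<Rightarrow> bool" where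
  "meager_in T S \<longleftrightarrow> (\<exists>F. countable F \<and> (\<forall>R\<in>F. rare_in T R) \<and> S = \<Union>F)"

definition residual_in :: "'a topology \<Rightarrow> 'a set \<Rightarrow> bool" where
  "residual_in T S \<longleftrightarrow> S \<subseteq> topspace T \<and> meager_in T (topspace T - S)"

primrec cantor_stage :: "nat \<Rightarrow> real set" where
  "cantor_stage 0 = {0..1}"
| "cantor_stage (Suc n) = (\<lambda>x. x / 3) ` cantor_stage n \<union> (\<lambda>x. (2 + x) / 3) ` cantor_stage n"

definition cantor_set :: "real set" where
  "cantor_set = (\<Inter>n. cantor_stage n)"

lemma metric_copy:
  fixes Z :: "'z metric" and h :: "'z \<Rightarrow> 'b"
  assumes "S \<subseteq> mspace Z" "inj_on h S"
  obtains Z' :: "'b metric" where "mspace Z' = h ` S"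
    "\<And>x y. x \<in> S \<Longrightarrow> y \<in> S \<Longrightarrow> mdist Z' (h x) (h y) = mdist Z x y"
proof -
  let ?k = "inv_into S h"
  define d where "d = (\<lambda>u v. mdist Z (?k u) (?k v))"
  have k: "?k u \<in> mspace Z" if "u \<in> h ` S" for u
    using inv_into_into[OF that] assms(1) by (rule subsetD[rotated])
  interpret Metric_space "h ` S" d
  proof
    fix u v w
    show "0 \<le> d u v" by (simp add: d_def)
    show "d u v = d v u" by (simp add: d_def mdist_commute)
    show "d u v = 0 \<longleftrightarrow> u = v" if "u \<in> h ` S" "v \<in> h ` S"
      using mdist_zero[OF k[OF that(1)] k[OF that(2)]] inv_into_injective[OF _ that]
      by (auto simp: d_def)
    show "d u w \<le> d u v + d v w" if "u \<in> h ` S" "v \<in> h ` S" "w \<in> h ` S"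
      unfolding d_def by (intro mdist_triangle k that)
  qed
  show thesis
    by (rule that[OF mspace_metric]) (simp only: mdist_metric, simp add: d_def assms(2))
qed

lemma compact_metric_lepoll_real:
  assumes "compact_metric X"
  shows "mspace X \<lesssim> (UNIV :: real set)"
proof -
  interpret Metric_space "mspace X" "mdist X" by simp
  have "compactin mtopology (mspace X)"
    using assms by (simp add: compact_metric_def mtopology_of_def compact_space_def)
  then have tb: "mtotally_bounded (mspace X)" by (rule compactin_imp_mtotally_bounded)
  have "\<exists>K. finite K \<and> K \<subseteq> mspace X \<and> mspace X \<subseteq> (\<Union>x\<in>K. mball x (1 / Suc n))" for n
  proof -
    have "0 < 1 / real (Suc n)" by simp
    then show ?thesis using tb unfolding mtotally_bounded_def by blast
  qed
  then obtain K where K: "\<And>n. finite (K n)"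
    "\<And>n. mspace X \<subseteq> (\<Union>x\<in>K n. mball x (1 / Suc n))" by metis
  define D where "D = Sigma UNIV K"
  have "countable D" unfolding D_def using K(1) by (intro countable_SIGMA) (auto intro: countable_finite)
  define F where "F x = to_nat_on D ` {(n, c) \<in> D. mdist X c x < 1 / Suc n}" for x
  have "inj_on F (mspace X)"
  proof (rule inj_onI, rule ccontr)
    fix x y assume xy: "x \<in> mspace X" "y \<in> mspace X" "F x = F y" "x \<noteq> y"
    have "{(n, c) \<in> D. mdist X c x < 1 / Suc n} = {(n, c) \<in> D. mdist X c y < 1 / Suc n}"
      using xy(3) \<open>countable D\<close> unfolding F_def
      by (subst (asm) inj_on_image_eq_iff[OF inj_on_to_nat_on]) auto
    then have eq: "\<And>n c. (n, c) \<in> D \<Longrightarrow> mdist X c x < 1 / Suc n \<longleftrightarrow> mdist X c y < 1 / Suc n"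
      by blast
    have "0 < mdist X x y / 2" using xy by simp
    then obtain n where n: "1 / Suc n < mdist X x y / 2" using nat_approx_posE by blast
    obtain c where c: "c \<in> K n" "x \<in> mball c (1 / Suc n)" using K(2)[of n] xy(1) by blast
    then have "(n, c) \<in> D" "c \<in> mspace X" "mdist X c x < 1 / Suc n" by (auto simp: D_def)
    moreover have "mdist X x y \<le> mdist X x c + mdist X c y"
      using xy \<open>c \<in> mspace X\<close> by (intro triangle) auto
    ultimately show False using eq[of n c] n commute[of c x] by linarith
  qed
  then have "mspace X \<lesssim> (UNIV :: nat set set)" unfolding lepoll_def by blast
  then show ?thesis using nat_sets_eqpoll_reals lepoll_trans2 by blast
qed

lemma compact_metric_isometric_real:
  assumes "compact_metric X"
  obtains Y :: "real metric" where "isometric X Y" "compact_metric Y"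
proof -
  obtain h :: "'a \<Rightarrow> real" where h: "inj_on h (mspace X)"
    using compact_metric_lepoll_real[OF assms] by (auto simp: lepoll_def)
  obtain Y :: "real metric" where Y: "mspace Y = h ` mspace X"
    "\<And>x y. x \<in> mspace X \<Longrightarrow> y \<in> mspace X \<Longrightarrow> mdist Y (h x) (h y) = mdist X x y"
    using metric_copy[OF subset_refl h] by blast
  have iso: "isometric X Y" using Y by (auto simp: isometric_def isometric_injection_def)
  moreover have "compact_metric Y"
    using assms Y(1) homeomorphic_compact_space[OF isometric_imp_homeomorphic_space[OF iso]]
    by (auto simp: compact_metric_def)
  ultimately show thesis using that by blast
qed

lemma gh_values_any_ambient:
  fixes X :: "'a metric" and Y :: "'b metric" and Z :: "'z metric"
  assumes "compact_metric X" "compact_metric Y"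
    and f: "isometric_injection X Z f" and g: "isometric_injection Y Z g"
  shows "hausdorff_dist Z (f ` mspace X) (g ` mspace Y) \<in> gh_values X Y"
proof -
  define S where "S = f ` mspace X \<union> g ` mspace Y"
  have im: "f ` mspace X \<lesssim> (UNIV :: real set)" "g ` mspace Y \<lesssim> (UNIV :: real set)"
    using assms compact_metric_lepoll_real lepoll_trans image_lepoll by metis+
  have sub: "S \<subseteq> mspace Z" using f g by (auto simp: S_def isometric_injection_def)
  have "S \<lesssim> (UNIV :: real set)"
  proof -
    obtain a b :: "'z \<Rightarrow> real" where ab: "inj_on a (f ` mspace X)" "inj_on b (g ` mspace Y)"
      using im by (auto simp: lepoll_def)
    define e :: "'z \<Rightarrow> real" where
      "e z = (if z \<in> f ` mspace X then arctan (a z) else arctan (b z) + 4)" for z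
    have "arctan u \<noteq> arctan v + 4" for u v
      using arctan_bounded[of u] arctan_bounded[of v] pi_less_4 by linarith
    then have "inj_on e S"
      using ab arctan_eq_iff unfolding e_def S_def inj_on_def
      by (smt (verit) Un_iff)
    then show ?thesis by (auto simp: lepoll_def)
  qed
  then obtain h :: "'z \<Rightarrow> real" where h: "inj_on h S" by (auto simp: lepoll_def)
  obtain Z' :: "real metric" where Z': "mspace Z' = h ` S"
    "\<And>x y. x \<in> S \<Longrightarrow> y \<in> S \<Longrightarrow> mdist Z' (h x) (h y) = mdist Z x y"
    using metric_copy[OF sub h] by blast
  have S: "\<And>x. x \<in> mspace X \<Longrightarrow> f x \<in> S" "\<And>y. y \<in> mspace Y \<Longrightarrow> g y \<in> S"
    by (auto simp: S_def)
  have "isometric_injection X Z' (h \<circ> f)" "isometric_injection Y Z' (h \<circ> g)"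
    using f g Z' S by (auto simp: isometric_injection_def)
  moreover have "hausdorff_dist Z' ((h \<circ> f) ` mspace X) ((h \<circ> g) ` mspace Y)
      = hausdorff_dist Z (f ` mspace X) (g ` mspace Y)"
    unfolding hausdorff_dist_def image_image comp_def
    by (intro arg_cong2[of _ _ _ _ max] SUP_cong INF_cong refl) (auto simp: Z' S)
  ultimately show ?thesis
    unfolding gh_values_def by (metis (mono_tags, lifting) mem_Collect_eq)
qed

lemma compact_metric_bounded:
  assumes "compact_metric X"
  obtains B where "\<And>x y. x \<in> mspace X \<Longrightarrow> y \<in> mspace X \<Longrightarrow> mdist X x y \<le> B"
proof -
  interpret Metric_space "mspace X" "mdist X" by simp
  have "compactin mtopology (mspace X)"
    using assms by (simp add: compact_metric_def mtopology_of_def compact_space_def)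
  then have "mbounded (mspace X)" by (rule compactin_imp_mbounded)
  then show thesis using that by (auto simp: mbounded_alt)
qed

lemma gh_values_nonempty:
  assumes "compact_metric X" "compact_metric Y"
  shows "gh_values X Y \<noteq> {}"
proof -
  obtain A where A: "\<And>x y. x \<in> mspace X \<Longrightarrow> y \<in> mspace X \<Longrightarrow> mdist X x y \<le> A"
    using compact_metric_bounded[OF assms(1)] by blast
  obtain B where B: "\<And>x y. x \<in> mspace Y \<Longrightarrow> y \<in> mspace Y \<Longrightarrow> mdist Y x y \<le> B"
    using compact_metric_bounded[OF assms(2)] by blast
  define C where "C = max 1 (max A B)"
  have C: "0 < C" "A \<le> C" "B \<le> C" by (auto simp: C_def)
  define d where "d u v = (case u of
      Inl x \<Rightarrow> (case v of Inl x' \<Rightarrow> mdist X x x' | Inr y' \<Rightarrow> C)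
    | Inr y \<Rightarrow> (case v of Inl x' \<Rightarrow> C | Inr y' \<Rightarrow> mdist Y y y'))" for u v
  interpret Metric_space "mspace X <+> mspace Y" d
  proof
    fix u v w
    show "0 \<le> d u v" using C by (auto simp: d_def split: sum.split)
    show "d u v = d v u" by (auto simp: d_def mdist_commute split: sum.split)
    show "d u v = 0 \<longleftrightarrow> u = v" if "u \<in> mspace X <+> mspace Y" "v \<in> mspace X <+> mspace Y"
      using that C by (auto simp: d_def)
    show "d u w \<le> d u v + d v w" if "u \<in> mspace X <+> mspace Y" "v \<in> mspace X <+> mspace Y"
      "w \<in> mspace X <+> mspace Y"
    proof -
      have "mdist X x x' \<le> C + C" if "x \<in> mspace X" "x' \<in> mspace X" for x x'
        using A[OF that] C by linarith
      moreover have "mdist Y y y' \<le> C + C" if "y \<in> mspace Y" "y' \<in> mspace Y" for y y'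
        using B[OF that] C by linarith
      ultimately show ?thesis using that by (auto simp: d_def mdist_triangle)
    qed
  qed
  have "isometric_injection X Self Inl" "isometric_injection Y Self Inr"
    by (auto simp: isometric_injection_def d_def)
  then show ?thesis using gh_values_any_ambient[OF assms] by blast
qed

end

theory Submission
  imports Defs
begin

text \<open>Call a compact space gapped at scale \<open>e\<close> if, for some \<open>0 \<le> 2a < b \<le> c < e\<close>, all
  distances lie outside \<open>]a, b[\<close> and every point has another one at distance in \<open>[b, c]\<close>. This is an
  open condition for the Gromov-Hausdorff distance, as strict inequalities survive small distortions,
  and it is dense: double the points of a finite net. A space that is gapped at every scale splits
  into clopen balls of radius below every \<open>e\<close> and has no isolated points, so that it is a Cantor
  space by Brouwer's characterisation.\<close>

subsection \<open>Correspondences and the Gromov-Hausdorff metric\<close>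

text \<open>Finite spaces come arbitrarily close to every compact space, so being a Cantor space is
  not itself an open condition; it has to be deduced from countably many quantitative conditions
  that are.

  The factor 2 in \<open>2 * a < b\<close> makes "at distance less than \<open>b\<close>"
  transitive: two such distances are at most \<open>a\<close> each and add up to less than
  \<open>b\<close>. Hence balls of radius \<open>b\<close> that meet coincide, and they are clopen.
  The finite models have \<open>a = 0\<close>; a positive \<open>a\<close> is what lets the
  condition survive a perturbation, which may turn a point into a small cluster.

  Ambient spaces are awkward to compose or to perturb, so all estimates go through correspondences:
  for compact spaces the Gromov-Hausdorff distance is half the infimum of their distortions.\<close>

lemma mdist_self: "x \<in> mspace X \<Longrightarrow> mdist X x x = 0"
  by simp

text \<open>The number \<open>e\<close> bounds the distortion. A Hausdorff distance below
  \<open>s\<close> produces distortion \<open>2 * s\<close>, whence the factors 2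
  throughout.\<close>

definition correspondence :: "'a metric \<Rightarrow> 'b metric \<Rightarrow> real \<Rightarrow> ('a \<times> 'b) set \<Rightarrow> bool" where
  "correspondence X Y e R \<longleftrightarrow>
     R \<subseteq> mspace X \<times> mspace Y \<and>
     (\<forall>x\<in>mspace X. \<exists>y. (x, y) \<in> R) \<and> (\<forall>y\<in>mspace Y. \<exists>x. (x, y) \<in> R) \<and>
     (\<forall>(x, y)\<in>R. \<forall>(x', y')\<in>R. \<bar>mdist X x x' - mdist Y y y'\<bar> \<le> e)"

lemma correspondence_mem:
  assumes "correspondence X Y e R" "(x, y) \<in> R"
  shows "x \<in> mspace X" "y \<in> mspace Y"
  using assms by (auto simp: correspondence_def)

lemma correspondence_obtain:
  assumes "correspondence X Y e R"
  shows "x \<in> mspace X \<Longrightarrow> \<exists>y. (x, y) \<in> R" "y \<in> mspace Y \<Longrightarrow> \<exists>x. (x, y) \<in> R"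
  using assms by (auto simp: correspondence_def)

lemma correspondence_distortion:
  assumes "correspondence X Y e R" "(x, y) \<in> R" "(x', y') \<in> R"
  shows "\<bar>mdist X x x' - mdist Y y y'\<bar> \<le> e"
  using assms unfolding correspondence_def by blast

lemma correspondence_converse:
  assumes "correspondence X Y e R"
  shows "correspondence Y X e (R\<inverse>)"
  using assms unfolding correspondence_def by (auto simp: abs_minus_commute)

text \<open>Distortions add up along a composition. This becomes the triangle inequality of
  \<open>gh_dist\<close> and avoids gluing two ambient spaces along the middle one.\<close>

lemma correspondence_relcomp:
  assumes R: "correspondence X Y e R" and S: "correspondence Y Z e' S"
  shows "correspondence X Z (e + e') (R O S)"
  unfolding correspondence_def
proof (intro conjI)
  show "R O S \<subseteq> mspace X \<times> mspace Z"
    using correspondence_mem[OF R] correspondence_mem[OF S] by blast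
  show "\<forall>x\<in>mspace X. \<exists>z. (x, z) \<in> R O S"
    using correspondence_obtain(1)[OF R] correspondence_obtain(1)[OF S] correspondence_mem(2)[OF R]
    by (meson relcomp.relcompI)
  show "\<forall>z\<in>mspace Z. \<exists>x. (x, z) \<in> R O S"
    using correspondence_obtain(2)[OF R] correspondence_obtain(2)[OF S] correspondence_mem(1)[OF S]
    by (meson relcomp.relcompI)
  show "\<forall>(x, z)\<in>R O S. \<forall>(x', z')\<in>R O S. \<bar>mdist X x x' - mdist Z z z'\<bar> \<le> e + e'"
  proof clarify
    fix x y z x' y' z' assume "(x, y) \<in> R" "(y, z) \<in> S" "(x', y') \<in> R" "(y', z') \<in> S"
    then have "\<bar>mdist X x x' - mdist Y y y'\<bar> \<le> e" "\<bar>mdist Y y y' - mdist Z z z'\<bar> \<le> e'"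
      using correspondence_distortion[OF R, of x y x' y'] correspondence_distortion[OF S, of y z y' z']
      by simp_all
    then show "\<bar>mdist X x x' - mdist Z z z'\<bar> \<le> e + e'" by linarith
  qed
qed

lemma correspondence_isometric:
  assumes "isometric X Y"
  obtains R where "correspondence X Y 0 R"
proof -
  obtain f where "isometric_injection X Y f" "f ` mspace X = mspace Y"
    using assms by (auto simp: isometric_def)
  then have "correspondence X Y 0 {(x, y). x \<in> mspace X \<and> y = f x}"
    by (auto simp: correspondence_def isometric_injection_def)
  then show thesis by (rule that)
qed

text \<open>The bound \<open>K\<close> makes the real suprema in \<open>hausdorff_dist\<close>
  genuine; over an unbounded family they would say nothing about single points.\<close>

lemma hausdorff_dist_lessD:
  assumes ne: "A \<noteq> {}" "B \<noteq> {}"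
    and K: "\<And>a b. a \<in> A \<Longrightarrow> b \<in> B \<Longrightarrow> mdist Z a b \<le> K"
    and less: "hausdorff_dist Z A B < s"
  shows "a \<in> A \<Longrightarrow> \<exists>b\<in>B. mdist Z a b < s" "b \<in> B \<Longrightarrow> \<exists>a\<in>A. mdist Z a b < s"
proof -
  have bdd: "bdd_below (mdist Z a ` B)" "bdd_below ((\<lambda>a. mdist Z a b) ` A)" for a b
    by (rule bdd_belowI2[of _ 0], simp)+
  have "bdd_above ((\<lambda>a. INF b\<in>B. mdist Z a b) ` A)"
  proof (rule bdd_aboveI2)
    obtain b where "b \<in> B" using ne(2) by blast
    then show "(INF b\<in>B. mdist Z a b) \<le> K" if "a \<in> A" for a
      using K that by (intro cINF_lower2[OF bdd(1)]) auto
  qed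
  moreover have "bdd_above ((\<lambda>b. INF a\<in>A. mdist Z a b) ` B)"
  proof (rule bdd_aboveI2)
    obtain a where "a \<in> A" using ne(1) by blast
    then show "(INF a\<in>A. mdist Z a b) \<le> K" if "b \<in> B" for b
      using K that by (intro cINF_lower2[OF bdd(2)]) auto
  qed
  ultimately have INF: "a \<in> A \<Longrightarrow> (INF b\<in>B. mdist Z a b) < s"
      "b \<in> B \<Longrightarrow> (INF a\<in>A. mdist Z a b) < s"
    using less cSUP_upper[of a A "\<lambda>a. INF b\<in>B. mdist Z a b"]
      cSUP_upper[of b B "\<lambda>b. INF a\<in>A. mdist Z a b"]
    unfolding hausdorff_dist_def by linarith+
  then show "a \<in> A \<Longrightarrow> \<exists>b\<in>B. mdist Z a b < s" "b \<in> B \<Longrightarrow> \<exists>a\<in>A. mdist Z a b < s"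
    using ne bdd by (simp_all add: cINF_less_iff)
qed

text \<open>Points whose images in the ambient space are closer than \<open>s\<close> correspond;
  moving both ends of a segment changes its length by at most \<open>2 * s\<close>.\<close>

lemma gh_values_less_correspondence:
  assumes "compact_metric X" "compact_metric Y" "r \<in> gh_values X Y" "r < s"
  obtains R where "correspondence X Y (2 * s) R"
proof -
  obtain Z :: "real metric" and f g where r: "r = hausdorff_dist Z (f ` mspace X) (g ` mspace Y)"
    and f: "isometric_injection X Z f" and g: "isometric_injection Y Z g"
    using assms(3) by (auto simp: gh_values_def)
  obtain x0 y0 where x0: "x0 \<in> mspace X" and y0: "y0 \<in> mspace Y"
    using assms(1,2) by (auto simp: compact_metric_def)
  obtain A where A: "\<And>x y. x \<in> mspace X \<Longrightarrow> y \<in> mspace X \<Longrightarrow> mdist X x y \<le> A"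
    using compact_metric_bounded[OF assms(1)] by blast
  obtain B where B: "\<And>x y. x \<in> mspace Y \<Longrightarrow> y \<in> mspace Y \<Longrightarrow> mdist Y x y \<le> B"
    using compact_metric_bounded[OF assms(2)] by blast
  have fZ: "f x \<in> mspace Z" if "x \<in> mspace X" for x
    using f that by (auto simp: isometric_injection_def)
  have gZ: "g y \<in> mspace Z" if "y \<in> mspace Y" for y
    using g that by (auto simp: isometric_injection_def)
  have fd: "mdist Z (f x) (f x') = mdist X x x'" if "x \<in> mspace X" "x' \<in> mspace X" for x x'
    using f that by (auto simp: isometric_injection_def)
  have gd: "mdist Z (g y) (g y') = mdist Y y y'" if "y \<in> mspace Y" "y' \<in> mspace Y" for y y'
    using g that by (auto simp: isometric_injection_def)
  \<comment> \<open>A detour through the base points bounds all cross distances, as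
    \<open>hausdorff_dist_lessD\<close> requires.\<close>
  have K: "mdist Z (f x) (g y) \<le> A + mdist Z (f x0) (g y0) + B"
    if "x \<in> mspace X" "y \<in> mspace Y" for x y
    using mdist_triangle[of "f x" Z "f x0" "g y"] mdist_triangle[of "f x0" Z "g y0" "g y"]
      A[OF that(1) x0] B[OF y0 that(2)] fd[OF that(1) x0] gd[OF y0 that(2)] fZ gZ that x0 y0
    by force
  define R where "R = {(x, y). x \<in> mspace X \<and> y \<in> mspace Y \<and> mdist Z (f x) (g y) < s}"
  have "\<exists>y\<in>mspace Y. mdist Z (f x) (g y) < s" if "x \<in> mspace X" for x
    using hausdorff_dist_lessD(1)[of "f ` mspace X" "g ` mspace Y" Z _ s "f x"]
      K r assms(4) x0 y0 that by fastforce
  moreover have "\<exists>x\<in>mspace X. mdist Z (f x) (g y) < s" if "y \<in> mspace Y" for y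
    using hausdorff_dist_lessD(2)[of "f ` mspace X" "g ` mspace Y" Z _ s "g y"]
      K r assms(4) x0 y0 that by fastforce
  moreover have "\<bar>mdist X x x' - mdist Y y y'\<bar> \<le> 2 * s" if "(x, y) \<in> R" "(x', y') \<in> R" for x y x' y'
  proof -
    have m: "f x \<in> mspace Z" "f x' \<in> mspace Z" "g y \<in> mspace Z" "g y' \<in> mspace Z"
      using that fZ gZ by (auto simp: R_def)
    have "mdist Z (f x) (f x') \<le> mdist Z (f x) (g y) + mdist Z (g y) (g y') + mdist Z (f x') (g y')"
      using mdist_triangle[of "f x" Z "g y" "f x'"] mdist_triangle[of "g y" Z "g y'" "f x'"]
        mdist_commute[of Z "g y'" "f x'"] m by linarith
    moreover have "mdist Z (g y) (g y') \<le> mdist Z (f x) (g y) + mdist Z (f x) (f x') + mdist Z (f x') (g y')"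
      using mdist_triangle[of "g y" Z "f x" "g y'"] mdist_triangle[of "f x" Z "f x'" "g y'"]
        mdist_commute[of Z "g y" "f x"] m by linarith
    ultimately show ?thesis using that fd gd by (auto simp: R_def)
  qed
  ultimately have "correspondence X Y (2 * s) R"
    unfolding correspondence_def by (force simp: R_def)
  then show thesis by (rule that)
qed

text \<open>The two spaces are glued by declaring corresponding points to be at distance \<^term>\<open>s\<close>.\<close>

lemma correspondence_gh_values:
  assumes X: "compact_metric X" and Y: "compact_metric Y"
    and R: "correspondence X Y (2 * s) R" and s: "0 < s"
  obtains r where "r \<in> gh_values X Y" "r \<le> s"
proof -
  \<comment> \<open>\<open>l x y p\<close> is the length of the path from \<open>x\<close> to
    \<open>y\<close> that crosses over at the pair \<open>p\<close> for a toll of \<open>s\<close>;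
    \<open>c\<close> is the infimum over all crossings.\<close>
  define l where "l x y p = mdist X x (fst p) + s + mdist Y (snd p) y" for x y p
  define c where "c x y = (INF p\<in>R. l x y p)" for x y
  have Rm: "fst p \<in> mspace X" "snd p \<in> mspace Y" if "p \<in> R" for p
    using correspondence_mem[OF R, of "fst p" "snd p"] that by simp_all
  have Rne: "R \<noteq> {}" using X R by (auto simp: correspondence_def compact_metric_def)
  have l_ge: "s \<le> l x y p" for x y p by (simp add: l_def)
  then have bdd: "bdd_below (l x y ` R)" for x y by (intro bdd_belowI2[of _ s]) auto
  have c_le: "c x y \<le> l x y p" if "p \<in> R" for x y p
    unfolding c_def using bdd that by (rule cINF_lower)
  have c_greatest: "u \<le> c x y" if "\<And>p. p \<in> R \<Longrightarrow> u \<le> l x y p" for u x y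
    unfolding c_def using Rne that by (rule cINF_greatest)
  have c_ge: "s \<le> c x y" for x y by (rule c_greatest) (rule l_ge)
  have c1: "c x y \<le> mdist X x x' + c x' y" if "x \<in> mspace X" "x' \<in> mspace X" for x x' y
  proof -
    have "c x y - mdist X x x' \<le> c x' y"
    proof (rule c_greatest)
      fix p assume "p \<in> R"
      then show "c x y - mdist X x x' \<le> l x' y p"
        using c_le[of p x y] mdist_triangle[of x X x' "fst p"] that Rm(1)[of p] by (simp add: l_def)
    qed
    then show ?thesis by simp
  qed
  have c2: "c x y \<le> c x y' + mdist Y y' y" if "y \<in> mspace Y" "y' \<in> mspace Y" for x y y'
  proof -
    have "c x y - mdist Y y' y \<le> c x y'"
    proof (rule c_greatest)
      fix p assume "p \<in> R"
      then show "c x y - mdist Y y' y \<le> l x y' p"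
        using c_le[of p x y] mdist_triangle[of "snd p" Y y' y] that Rm(2)[of p] by (simp add: l_def)
    qed
    then show ?thesis by simp
  qed
  have c1': "c x y \<le> c x' y + mdist X x' x" if "x \<in> mspace X" "x' \<in> mspace X" for x x' y
    using c1[OF that, of y] mdist_commute[of X x x'] by simp
  have c2': "c x y \<le> mdist Y y y' + c x y'" if "y \<in> mspace Y" "y' \<in> mspace Y" for x y y'
    using c2[OF that, of x] mdist_commute[of Y y y'] by simp
  have ll: "\<bar>mdist X (fst p) (fst q) - mdist Y (snd p) (snd q)\<bar> \<le> 2 * s" if "p \<in> R" "q \<in> R" for p q
    using correspondence_distortion[OF R, of "fst p" "snd p" "fst q" "snd q"] that by simp
  \<comment> \<open>Leaving \<open>X\<close> at \<open>p\<close> and returning at \<open>q\<close>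
    costs two tolls, and \<open>2 * s\<close> is the most by which the way through \<open>Y\<close>
    can be shorter. The same holds with the spaces exchanged in \<open>c4\<close>.\<close>
  have c3: "mdist X x x' \<le> c x y + c x' y"
    if "x \<in> mspace X" "x' \<in> mspace X" "y \<in> mspace Y" for x x' y
  proof -
    have "mdist X x x' - c x' y \<le> c x y"
    proof (rule c_greatest)
      fix p assume p: "p \<in> R"
      have "mdist X x x' - l x y p \<le> c x' y"
      proof (rule c_greatest)
        fix q assume q: "q \<in> R"
        show "mdist X x x' - l x y p \<le> l x' y q"
          using ll[OF p q] that Rm[OF p] Rm[OF q] mdist_triangle[of x X "fst p" x']
            mdist_triangle[of "fst p" X "fst q" x'] mdist_triangle[of "snd p" Y y "snd q"]
            mdist_commute[of X x' "fst q"] mdist_commute[of Y y "snd q"]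
          unfolding l_def by linarith
      qed
      then show "mdist X x x' - c x' y \<le> l x y p" by linarith
    qed
    then show ?thesis by simp
  qed
  have c4: "mdist Y y y' \<le> c x y + c x y'"
    if "x \<in> mspace X" "y \<in> mspace Y" "y' \<in> mspace Y" for x y y'
  proof -
    have "mdist Y y y' - c x y' \<le> c x y"
    proof (rule c_greatest)
      fix p assume p: "p \<in> R"
      have "mdist Y y y' - l x y p \<le> c x y'"
      proof (rule c_greatest)
        fix q assume q: "q \<in> R"
        show "mdist Y y y' - l x y p \<le> l x y' q"
          using ll[OF p q] that Rm[OF p] Rm[OF q] mdist_triangle[of y Y "snd p" y']
            mdist_triangle[of "snd p" Y "snd q" y'] mdist_triangle[of "fst p" X x "fst q"]
            mdist_commute[of Y y "snd p"] mdist_commute[of X x "fst p"]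
          unfolding l_def by linarith
      qed
      then show "mdist Y y y' - c x y' \<le> l x y p" by linarith
    qed
    then show ?thesis by simp
  qed
  have near: "c x y \<le> s" if "(x, y) \<in> R" for x y
  proof -
    have "mdist X x x = 0" "mdist Y y y = 0" using Rm[OF that] by (simp_all add: mdist_self)
    then show ?thesis using c_le[OF that, of x y] by (simp add: l_def)
  qed
  define d where "d u v = (case u of
      Inl x \<Rightarrow> (case v of Inl x' \<Rightarrow> mdist X x x' | Inr y' \<Rightarrow> c x y')
    | Inr y \<Rightarrow> (case v of Inl x' \<Rightarrow> c x' y | Inr y' \<Rightarrow> mdist Y y y'))" for u v
  interpret Metric_space "mspace X <+> mspace Y" d
  proof
    fix u v w
    have c0: "0 < c x y" for x y using c_ge[of x y] s by linarith
    then show "0 \<le> d u v" by (auto simp: d_def less_imp_le split: sum.split)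
    show "d u v = d v u" by (auto simp: d_def mdist_commute split: sum.split)
    show "d u v = 0 \<longleftrightarrow> u = v" if "u \<in> mspace X <+> mspace Y" "v \<in> mspace X <+> mspace Y"
      using that c0 by (auto simp: d_def less_le)
    show "d u w \<le> d u v + d v w" if "u \<in> mspace X <+> mspace Y" "v \<in> mspace X <+> mspace Y"
      "w \<in> mspace X <+> mspace Y"
      using that by (auto simp: d_def intro: mdist_triangle c1 c1' c2 c2' c3 c4)
  qed
  have inj: "isometric_injection X Self Inl" "isometric_injection Y Self Inr"
    by (auto simp: isometric_injection_def d_def)
  have XY: "mspace X \<noteq> {}" "mspace Y \<noteq> {}" using X Y by (auto simp: compact_metric_def)
  have bdd': "bdd_below (c x ` mspace Y)" "bdd_below ((\<lambda>x. c x y) ` mspace X)" for x y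
    using c_ge by (auto intro!: bdd_belowI2[of _ s])
  have "(INF y\<in>mspace Y. c x y) \<le> s" if x: "x \<in> mspace X" for x
  proof -
    obtain y where "(x, y) \<in> R" using correspondence_obtain(1)[OF R x] by blast
    then show ?thesis
      using near correspondence_mem[OF R] by (intro cINF_lower2[OF bdd'(1)]) auto
  qed
  moreover have "(INF x\<in>mspace X. c x y) \<le> s" if y: "y \<in> mspace Y" for y
  proof -
    obtain x where "(x, y) \<in> R" using correspondence_obtain(2)[OF R y] by blast
    then show ?thesis
      using near correspondence_mem[OF R] by (intro cINF_lower2[OF bdd'(2)]) auto
  qed
  ultimately have "hausdorff_dist Self (Inl ` mspace X) (Inr ` mspace Y) \<le> s"
    using XY by (auto simp: hausdorff_dist_def image_image d_def intro!: cSUP_least)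
  \<comment> \<open>The glued space lives on a sum type; \<open>gh_values_any_ambient\<close>
    replaces it by an ambient space on a set of reals.\<close>
  then show thesis
    using that gh_values_any_ambient[OF X Y inj] by blast
qed

lemma gh_values_nonneg:
  assumes "compact_metric X" "compact_metric Y" "r \<in> gh_values X Y"
  shows "0 \<le> r"
proof (rule ccontr)
  assume "\<not> 0 \<le> r"
  \<comment> \<open>A negative \<open>r\<close> lies below \<open>r / 2\<close>, which would give a
    correspondence of negative distortion.\<close>
  then obtain R where R: "correspondence X Y (2 * (r / 2)) R"
    using gh_values_less_correspondence[OF assms, of "r / 2"] by auto
  obtain x where "x \<in> mspace X" using assms(1) by (auto simp: compact_metric_def)
  then obtain y where "(x, y) \<in> R" using correspondence_obtain[OF R] by blast
  then show False using correspondence_distortion[OF R, of x y x y] \<open>\<not> 0 \<le> r\<close> by simp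
qed

section \<open>The Gromov-Hausdorff space as a metric space\<close>

lemma compact_metric_rep_gh: "compact_metric (rep_gh_space Z)"
  using Quotient3_rep_reflp[OF Quotient3_gh_space] by blast

lemma isometric_rep_abs_gh:
  assumes "compact_metric X"
  shows "isometric (rep_gh_space (abs_gh_space X)) X"
  using Quotient3_rep_abs[OF Quotient3_gh_space, of X] assms isometric_refl by blast

lemma gh_space_eqI:
  assumes "isometric (rep_gh_space Z) (rep_gh_space W)"
  shows "Z = W"
  using Quotient3_rel_rep[OF Quotient3_gh_space, of Z W] assms compact_metric_rep_gh by blast

lemma gh_dist_rep: "gh_dist Z W = Inf (gh_values (rep_gh_space Z) (rep_gh_space W))"
  by (simp add: gh_dist_def)

lemma gh_dist_nonneg: "0 \<le> gh_dist Z W"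
  unfolding gh_dist_rep
  by (intro cInf_greatest gh_values_nonempty compact_metric_rep_gh)
    (rule gh_values_nonneg[OF compact_metric_rep_gh compact_metric_rep_gh])

lemma gh_dist_less_correspondence:
  assumes "gh_dist Z W < s"
  obtains R where "correspondence (rep_gh_space Z) (rep_gh_space W) (2 * s) R"
proof -
  obtain r where "r \<in> gh_values (rep_gh_space Z) (rep_gh_space W)" "r < s"
    using cInf_lessD[OF gh_values_nonempty[OF compact_metric_rep_gh compact_metric_rep_gh]
        assms[unfolded gh_dist_rep]] by blast
  then show thesis
    using that gh_values_less_correspondence[OF compact_metric_rep_gh compact_metric_rep_gh] by blast
qed

text \<open>Positivity of \<open>s\<close> comes from the gluing, where corresponding points stay
  \<open>s\<close> apart. A correspondence of distortion 0 therefore bounds the distance by every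
  positive \<open>s\<close>, and 0 is reached in the limit.\<close>

lemma correspondence_gh_dist_le:
  assumes R: "correspondence (rep_gh_space Z) (rep_gh_space W) e R" and "e \<le> 2 * s" "0 < s"
  shows "gh_dist Z W \<le> s"
proof -
  have "correspondence (rep_gh_space Z) (rep_gh_space W) (2 * s) R"
    using R assms(2) unfolding correspondence_def by fastforce
  then obtain r where r: "r \<in> gh_values (rep_gh_space Z) (rep_gh_space W)" "r \<le> s"
    using correspondence_gh_values[OF compact_metric_rep_gh compact_metric_rep_gh _ assms(3)] by blast
  have "bdd_below (gh_values (rep_gh_space Z) (rep_gh_space W))"
    by (rule bdd_belowI[of _ 0])
      (rule gh_values_nonneg[OF compact_metric_rep_gh compact_metric_rep_gh])
  then show ?thesis
    unfolding gh_dist_rep using r by (intro cInf_lower2[of r])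
qed

lemma gh_dist_commute_le: "gh_dist Z W \<le> gh_dist W Z"
proof (rule field_le_epsilon)
  fix e :: real assume "0 < e"
  then obtain R where "correspondence (rep_gh_space W) (rep_gh_space Z) (2 * (gh_dist W Z + e)) R"
    using gh_dist_less_correspondence[of W Z "gh_dist W Z + e"] by auto
  then show "gh_dist Z W \<le> gh_dist W Z + e"
    using \<open>0 < e\<close> gh_dist_nonneg[of W Z]
    by (intro correspondence_gh_dist_le[OF correspondence_converse]) auto
qed

lemma gh_dist_triangle: "gh_dist Z V \<le> gh_dist Z W + gh_dist W V"
proof (rule field_le_epsilon)
  fix e :: real assume e: "0 < e"
  obtain R where R: "correspondence (rep_gh_space Z) (rep_gh_space W) (2 * (gh_dist Z W + e / 2)) R"
    using e gh_dist_less_correspondence[of Z W "gh_dist Z W + e / 2"] by auto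
  obtain S where S: "correspondence (rep_gh_space W) (rep_gh_space V) (2 * (gh_dist W V + e / 2)) S"
    using e gh_dist_less_correspondence[of W V "gh_dist W V + e / 2"] by auto
  show "gh_dist Z V \<le> gh_dist Z W + gh_dist W V + e"
    using e gh_dist_nonneg[of Z W] gh_dist_nonneg[of W V]
    by (intro correspondence_gh_dist_le[OF correspondence_relcomp[OF R S]]) auto
qed

text \<open>Adjointness \<^prop>\<open>mdist Y (f x) y = mdist X x (g y)\<close> makes \<open>f\<close> an isometry with inverse
  \<open>g\<close>, and it is a closed condition on the pair \<open>(f, g)\<close> in a product of compact spaces, so a
  cluster point of adjoint pairs up to \<open>e\<close> is an isometry.\<close>

lemma isometric_if_correspondences:
  fixes X :: "'a metric" and Y :: "'b metric"
  assumes X: "compact_metric X" and Y: "compact_metric Y"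
    and R: "\<And>e. 0 < e \<Longrightarrow> \<exists>R. correspondence X Y e R"
  shows "isometric X Y"
proof -
  \<comment> \<open>Tychonoff supplies the cluster point: the approximate maps are arbitrary
    selections from correspondences, without any continuity.\<close>
  define T where "T = prod_topology
    (product_topology (\<lambda>_. mtopology_of Y) (mspace X)) (product_topology (\<lambda>_. mtopology_of X) (mspace Y))"
  have T: "compact_space T"
    using X Y by (simp add: T_def compact_space_prod_topology compact_space_product_topology
        compact_metric_def)
  define C where "C n = {p \<in> topspace T. \<forall>x\<in>mspace X. \<forall>y\<in>mspace Y.
     \<bar>mdist Y (fst p x) y - mdist X x (snd p y)\<bar> \<le> 1 / Suc n}" for n
  have closed: "closedin T (C n)" for n
  proof -
    have "closedin T {p \<in> topspace T. \<bar>mdist Y (fst p x) y - mdist X x (snd p y)\<bar> \<in> {.. 1 / Suc n}}"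
      if "x \<in> mspace X" "y \<in> mspace Y" for x y
    proof (rule closedin_continuous_map_preimage[of T euclideanreal])
      have "continuous_map T (mtopology_of Y) (\<lambda>p. fst p x)"
        unfolding T_def using that(1) continuous_map_compose[OF continuous_map_fst
            continuous_map_product_projection] by (fastforce simp: comp_def)
      moreover have "continuous_map T (mtopology_of X) (\<lambda>p. snd p y)"
        unfolding T_def using that(2) continuous_map_compose[OF continuous_map_snd
            continuous_map_product_projection] by (fastforce simp: comp_def)
      ultimately show "continuous_map T euclideanreal (\<lambda>p. \<bar>mdist Y (fst p x) y - mdist X x (snd p y)\<bar>)"
        using that by (intro continuous_intros) auto
      show "closedin euclideanreal {.. 1 / real (Suc n)}" by simp
    qed
    then have "closedin T (\<Inter>x\<in>mspace X. \<Inter>y\<in>mspace Y.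
        {p \<in> topspace T. \<bar>mdist Y (fst p x) y - mdist X x (snd p y)\<bar> \<in> {.. 1 / Suc n}})"
      using X Y by (intro closedin_INT) (auto simp: compact_metric_def)
    moreover have "C n = (\<Inter>x\<in>mspace X. \<Inter>y\<in>mspace Y.
        {p \<in> topspace T. \<bar>mdist Y (fst p x) y - mdist X x (snd p y)\<bar> \<in> {.. 1 / Suc n}})"
      using X Y by (auto simp: C_def compact_metric_def)
    ultimately show ?thesis by simp
  qed
  have ne: "C n \<noteq> {}" for n
  proof -
    obtain R where R: "correspondence X Y (1 / Suc n) R" using R[of "1 / Suc n"] by auto
    obtain f where f: "\<And>x. x \<in> mspace X \<Longrightarrow> (x, f x) \<in> R"
      using correspondence_obtain(1)[OF R] by metis
    obtain g where g: "\<And>y. y \<in> mspace Y \<Longrightarrow> (g y, y) \<in> R"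
      using correspondence_obtain(2)[OF R] by metis
    have "\<bar>mdist Y (f x) y - mdist X x (g y)\<bar> \<le> 1 / Suc n" if "x \<in> mspace X" "y \<in> mspace Y" for x y
      using correspondence_distortion[OF R f[OF that(1)] g[OF that(2)]] by linarith
    then have "(restrict f (mspace X), restrict g (mspace Y)) \<in> C n"
      using correspondence_mem[OF R f] correspondence_mem[OF R g] by (auto simp: C_def T_def)
    then show ?thesis by blast
  qed
  have "decseq C"
  proof (rule antimonoI)
    fix m n :: nat assume "m \<le> n"
    then have "1 / real (Suc n) \<le> 1 / real (Suc m)" by (simp add: frac_le)
    then show "C n \<subseteq> C m" by (fastforce simp: C_def)
  qed
  then obtain p where p: "\<And>n. p \<in> C n" using compact_space_imp_nest[OF T, of C] closed ne by blast
  define f g where "f = fst p" and "g = snd p"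
  have f: "f x \<in> mspace Y" if "x \<in> mspace X" for x
    using p[of 0] that by (auto simp: C_def T_def f_def PiE_iff)
  have g: "g y \<in> mspace X" if "y \<in> mspace Y" for y
    using p[of 0] that by (auto simp: C_def T_def g_def PiE_iff)
  have adj: "mdist Y (f x) y = mdist X x (g y)" if "x \<in> mspace X" "y \<in> mspace Y" for x y
  proof (rule ccontr)
    assume "\<not> ?thesis"
    then have "0 < \<bar>mdist Y (f x) y - mdist X x (g y)\<bar>" by simp
    then obtain n where "1 / Suc n < \<bar>mdist Y (f x) y - mdist X x (g y)\<bar>" by (rule nat_approx_posE)
    then show False using p[of n] that by (force simp: C_def f_def g_def)
  qed
  \<comment> \<open>At \<open>x = g y\<close> the right-hand side of adjointness vanishes.\<close>
  have fg: "f (g y) = y" if "y \<in> mspace Y" for y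
    using adj[OF g[OF that] that] f[OF g[OF that]] mdist_self[OF g[OF that]] that by simp
  have gf: "g (f x) = x" if "x \<in> mspace X" for x
    using adj[OF that f[OF that]] g[OF f[OF that]] mdist_self[OF f[OF that]] that by simp
  have "mdist Y (f x) (f x') = mdist X x x'" if "x \<in> mspace X" "x' \<in> mspace X" for x x'
    using adj[OF that(1) f[OF that(2)]] gf that by simp
  then show ?thesis
    unfolding isometric_def isometric_injection_def
    using f g fg by (intro exI[of _ f]) force
qed

text \<open>\<open>gh_topology\<close> is built with \<open>Metric_space.mtopology\<close>, so its
  open sets are those given by balls only once \<open>gh_dist\<close> is known to be a
  metric.\<close>

lemma Metric_space_gh_dist: "Metric_space UNIV gh_dist"
proof
  fix Z W V :: gh_space
  show "0 \<le> gh_dist Z W" by (rule gh_dist_nonneg)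
  show "gh_dist Z W = gh_dist W Z" by (intro antisym gh_dist_commute_le)
  show "gh_dist Z V \<le> gh_dist Z W + gh_dist W V" by (rule gh_dist_triangle)
  show "gh_dist Z W = 0 \<longleftrightarrow> Z = W"
  proof
    assume 0: "gh_dist Z W = 0"
    have "\<exists>R. correspondence (rep_gh_space Z) (rep_gh_space W) e R" if "0 < e" for e
      using gh_dist_less_correspondence[of Z W "e / 2"] 0 that by auto
    then show "Z = W"
      by (intro gh_space_eqI isometric_if_correspondences compact_metric_rep_gh)
  next
    assume "Z = W"
    moreover obtain R where R: "correspondence (rep_gh_space Z) (rep_gh_space Z) 0 R"
      using correspondence_isometric[OF isometric_refl] .
    ultimately have "gh_dist Z W \<le> e" if "0 < e" for e
      using correspondence_gh_dist_le[OF R, of e] that by simp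
    then show "gh_dist Z W = 0"
      using gh_dist_nonneg[of Z W] field_le_epsilon[of "gh_dist Z W" 0] by simp
  qed
qed

subsection \<open>Topological characterisation of the Cantor set\<close>

text \<open>Cells are halved recursively, at step \<open>n\<close> along the \<open>n\<close>-th clopen set if that set cuts the
  cell and along an arbitrary clopen set that does otherwise. So every clopen set of the family is
  used up, and distinct points end up in different cells.\<close>

lemma homeomorphic_Cantor_cube:
  fixes T :: "'a topology"
  assumes compact: "compact_space T" and ne: "topspace T \<noteq> {}"
    and count: "countable \<B>"
    and clopen: "\<And>B. B \<in> \<B> \<Longrightarrow> openin T B" "\<And>B. B \<in> \<B> \<Longrightarrow> closedin T B"
    and sep: "\<And>x y. x \<in> topspace T \<Longrightarrow> y \<in> topspace T \<Longrightarrow> x \<noteq> y \<Longrightarrow> \<exists>B\<in>\<B>. x \<in> B \<longleftrightarrow> y \<notin> B"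
    and perfect: "\<And>U x. openin T U \<Longrightarrow> x \<in> U \<Longrightarrow> \<exists>y\<in>U. y \<noteq> x"
  shows "T homeomorphic_space product_topology (\<lambda>_::nat. discrete_topology (UNIV :: bool set)) UNIV"
proof -
  have "\<B> \<noteq> {}" using ne perfect[OF openin_topspace] sep by blast
  define B where "B = from_nat_into \<B>"
  have B: "openin T (B n)" "closedin T (B n)" for n
    using clopen from_nat_into[OF \<open>\<B> \<noteq> {}\<close>] by (auto simp: B_def)
  have sepB: "\<exists>n. x \<in> B n \<longleftrightarrow> y \<notin> B n" if "x \<in> topspace T" "y \<in> topspace T" "x \<noteq> y" for x y
    using sep[OF that] from_nat_into_surj[OF count] unfolding B_def by metis
  define cuts where "cuts C m \<longleftrightarrow> C \<inter> B m \<noteq> {} \<and> C - B m \<noteq> {}" for C m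
  define split where "split n C = (if cuts C n then B n else B (SOME m. cuts C m))" for n C
  define half where "half n C b = (if b then C \<inter> split n C else C - split n C)" for n C b
  \<comment> \<open>\<open>cell s\<close> follows a prescribed sequence of bits,
    \<open>cur x\<close> follows a point, and \<open>code x\<close> records the bits met on the way;
    \<open>code\<close> will be the homeomorphism.\<close>
  define cell where "cell s = rec_nat (topspace T) (\<lambda>n C. half n C (s n))" for s :: "nat \<Rightarrow> bool"
  define cur where "cur x = rec_nat (topspace T) (\<lambda>n C. half n C (x \<in> split n C))" for x
  define code where "code x n \<longleftrightarrow> x \<in> split n (cur x n)" for x n
  have cell_simps: "cell s 0 = topspace T" "cell s (Suc n) = half n (cell s n) (s n)" for s n
    by (simp_all add: cell_def)
  have cur_simps: "cur x 0 = topspace T" "cur x (Suc n) = half n (cur x n) (code x n)" for x n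
    by (simp_all add: cur_def code_def)
  have half_ne: "half n C b \<noteq> {}" if C: "openin T C" "C \<noteq> {}" for n C b
  proof -
    \<comment> \<open>Perfectness puts two points into \<open>C\<close>, and a clopen set of the
      family separating them cuts \<open>C\<close>; so the choice by \<open>SOME\<close> is
      legitimate.\<close>
    obtain x y where "x \<in> C" "y \<in> C" "x \<noteq> y" using C perfect by blast
    then obtain m where "cuts C m"
      using sepB[of x y] openin_subset[OF C(1)] unfolding cuts_def by blast
    then have "cuts C (SOME m. cuts C m)" by (rule someI)
    then show ?thesis by (auto simp: half_def split_def cuts_def)
  qed
  have half_clopen: "openin T (half n C b)" "closedin T (half n C b)"
    if "openin T C" "closedin T C" for n C b
    using that B by (auto simp: half_def split_def)
  have cell: "openin T (cell s n)" "closedin T (cell s n)" "cell s n \<noteq> {}" for s n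
  proof -
    have "openin T (cell s n) \<and> closedin T (cell s n) \<and> cell s n \<noteq> {}"
      using ne by (induction n) (simp_all add: cell_simps half_clopen half_ne)
    then show "openin T (cell s n)" "closedin T (cell s n)" "cell s n \<noteq> {}" by auto
  qed
  have cell_code: "cell (code x) n = cur x n" for x n
    by (induction n) (simp_all add: cell_simps cur_simps)
  have mem_cur: "x \<in> cur x n" if "x \<in> topspace T" for x n
    by (induction n) (use that in \<open>auto simp: cur_simps half_def code_def\<close>)
  have cur_eq: "cur y n = cur x n" if "y \<in> cur x n" for x y n
    using that
  proof (induction n)
    case (Suc n)
    then have "cur y n = cur x n" by (auto simp: cur_simps half_def split: if_splits)
    then show ?case using Suc.prems by (auto simp: cur_simps half_def code_def split: if_splits)
  qed (simp add: cur_simps)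
  \<comment> \<open>Bit \<open>n\<close> is decided in passing from stage \<open>n\<close> to stage
    \<open>Suc n\<close>; hence the shift by one here and in the surjectivity argument.\<close>
  have code_eq: "code y n = code x n" if "y \<in> cur x (Suc n)" for x y n
  proof -
    have "y \<in> cur x n" using that by (auto simp: cur_simps half_def split: if_splits)
    from cur_eq[OF this] show ?thesis
      using that by (auto simp: cur_simps half_def code_def split: if_splits)
  qed
  let ?P = "product_topology (\<lambda>_::nat. discrete_topology (UNIV :: bool set)) UNIV"
  have "continuous_map T ?P code"
    unfolding continuous_map_componentwise_UNIV
  proof
    fix n
    have "openin T {x \<in> topspace T. code x n \<in> U}" for U
    proof (subst openin_subopen, safe)
      fix x assume x: "x \<in> topspace T" "code x n \<in> U"
      have "openin T (cur x (Suc n))" using cell(1)[of "code x" "Suc n"] by (simp only: cell_code)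
      moreover have "cur x (Suc n) \<subseteq> {x \<in> topspace T. code x n \<in> U}"
        using code_eq[of _ x n] x(2) openin_subset[OF calculation] by auto
      ultimately show "\<exists>V. openin T V \<and> x \<in> V \<and> V \<subseteq> {x \<in> topspace T. code x n \<in> U}"
        using mem_cur[OF x(1)] by blast
    qed
    then show "continuous_map T (discrete_topology UNIV) (\<lambda>x. code x n)"
      by (simp add: continuous_map_def)
  qed
  moreover have "code ` topspace T = topspace ?P"
  proof -
    have "s \<in> code ` topspace T" for s
    proof -
      have "decseq (cell s)"
        by (rule decseq_SucI) (auto simp: cell_simps half_def)
      then obtain x where x: "\<And>n. x \<in> cell s n"
        using compact_space_imp_nest[OF compact, of "cell s", OF cell(2,3)] by blast
      have "cur x n = cell s n \<and> code x n = s n" for n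
      proof (induction n)
        case 0
        then show ?case using x[of 1] by (auto simp: cur_simps cell_simps half_def code_def split: if_splits)
      next
        case (Suc n)
        then have "cur x (Suc n) = cell s (Suc n)" by (simp add: cur_simps cell_simps)
        then show ?case
          using x[of "Suc (Suc n)"] cell_simps(2)[of s "Suc n"]
          by (auto simp: half_def code_def split: if_splits)
      qed
      then have "code x = s" by auto
      then show ?thesis using x[of 0] by (auto simp: cell_simps)
    qed
    then show ?thesis by (auto simp: PiE_UNIV_domain)
  qed
  moreover have "inj_on code (topspace T)"
  proof (rule inj_onI, rule ccontr)
    fix x y assume xy: "x \<in> topspace T" "y \<in> topspace T" "code x = code y" "x \<noteq> y"
    obtain m where m: "x \<in> B m \<longleftrightarrow> y \<notin> B m" using sepB xy by blast
    have eq: "cur x m = cur y m" using xy(3) cell_code by metis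
    have "cuts (cur x m) m"
      using m mem_cur[OF xy(1), of m] mem_cur[OF xy(2), of m] eq by (auto simp: cuts_def)
    then have "split m (cur x m) = B m" by (simp add: split_def)
    then show False using m eq fun_cong[OF xy(3), of m] by (simp add: code_def)
  qed
  moreover have "Hausdorff_space ?P"
    by (simp add: Hausdorff_space_product_topology)
  ultimately have "homeomorphic_map T ?P code"
    using compact by (intro continuous_imp_homeomorphic_map)
  then show ?thesis by (rule homeomorphic_map_imp_homeomorphic_space)
qed

section \<open>The middle thirds set is a Cantor cube\<close>

lemma cantor_stage_subset: "cantor_stage n \<subseteq> {0..1}"
  by (induction n) auto

lemma cantor_set_subset: "cantor_set \<subseteq> {0..1}"
  using cantor_stage_subset[of 0] unfolding cantor_set_def by blast

lemma compact_cantor_set: "compact cantor_set"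
proof -
  have "compact (cantor_stage n)" for n
    by (induction n) (auto intro!: compact_Un compact_continuous_image continuous_intros)
  then have "closed cantor_set" unfolding cantor_set_def by (intro closed_INT) (auto intro: compact_imp_closed)
  then show ?thesis
    using bounded_subset[OF bounded_closed_interval cantor_set_subset] by (simp add: compact_eq_bounded_closed)
qed

lemma cantor_set_0_1: "0 \<in> cantor_set" "1 \<in> cantor_set"
proof -
  have "0 \<in> cantor_stage n \<and> 1 \<in> cantor_stage n" for n
    by (induction n) (auto simp: image_iff intro: bexI[of _ 1])
  then show "0 \<in> cantor_set" "1 \<in> cantor_set" by (auto simp: cantor_set_def)
qed

lemma cantor_set_thirds:
  assumes "x \<in> cantor_set"
  shows "x / 3 \<in> cantor_set" "(2 + x) / 3 \<in> cantor_set"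
proof -
  have "x / 3 \<in> cantor_stage n \<and> (2 + x) / 3 \<in> cantor_stage n" for n
    using assms cantor_set_subset by (cases n) (auto simp: cantor_set_def)
  then show "x / 3 \<in> cantor_set" "(2 + x) / 3 \<in> cantor_set" by (auto simp: cantor_set_def)
qed

text \<open>Each stage offers its own preimage of \<open>x\<close>; comparing \<open>x\<close> with
  1/2 selects the same branch at all stages, so one preimage lies in all of them.\<close>

lemma cantor_set_cases:
  assumes "x \<in> cantor_set"
  obtains y where "y \<in> cantor_set" "x = y / 3" | y where "y \<in> cantor_set" "x = (2 + y) / 3"
proof (cases "x \<le> 1 / 2")
  case True
  have "3 * x \<in> cantor_stage n" for n
  proof -
    have "x \<in> cantor_stage (Suc n)" using assms by (simp only: cantor_set_def) blast
    then obtain y where y: "y \<in> cantor_stage n" "x = y / 3 \<or> x = (2 + y) / 3" by auto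
    moreover have "0 \<le> y" "y \<le> 1" using subsetD[OF cantor_stage_subset y(1)] by auto
    ultimately have "3 * x = y" using True by auto
    then show ?thesis using y(1) by simp
  qed
  then show thesis using that(1)[of "3 * x"] by (simp add: cantor_set_def)
next
  case False
  have "3 * x - 2 \<in> cantor_stage n" for n
  proof -
    have "x \<in> cantor_stage (Suc n)" using assms by (simp only: cantor_set_def) blast
    then obtain y where y: "y \<in> cantor_stage n" "x = y / 3 \<or> x = (2 + y) / 3" by auto
    moreover have "0 \<le> y" "y \<le> 1" using subsetD[OF cantor_stage_subset y(1)] by auto
    ultimately have "3 * x - 2 = y" using False by auto
    then show ?thesis using y(1) by simp
  qed
  then show thesis using that(2)[of "3 * x - 2"] by (simp add: cantor_set_def)
qed

text \<open>Self-similarity: an endpoint 0 or 1 serves at scale 1, and the map onto the third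
  containing \<open>x\<close> shrinks a partner's distance by 3.\<close>

lemma cantor_set_no_isolated:
  assumes "x \<in> cantor_set"
  shows "\<exists>y\<in>cantor_set. y \<noteq> x \<and> \<bar>x - y\<bar> \<le> 1 / 3 ^ n"
  using assms
proof (induction n arbitrary: x)
  case 0
  then have "0 \<le> x" "x \<le> 1" using cantor_set_subset by auto
  then show ?case using cantor_set_0_1 by (cases "x = 0") (auto intro: bexI[of _ 0] bexI[of _ 1])
next
  case (Suc n)
  from Suc.prems show ?case
  proof (cases rule: cantor_set_cases)
    case (1 z)
    obtain y where "y \<in> cantor_set" "y \<noteq> z" "\<bar>z - y\<bar> \<le> 1 / 3 ^ n" using Suc.IH[OF 1(1)] by blast
    moreover have "x - y / 3 = (z - y) / 3" using 1(2) by (simp add: diff_divide_distrib)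
    ultimately show ?thesis using 1(2) cantor_set_thirds(1) by (intro bexI[of _ "y / 3"]) auto
  next
    case (2 z)
    obtain y where y: "y \<in> cantor_set" "y \<noteq> z" "\<bar>z - y\<bar> \<le> 1 / 3 ^ n" using Suc.IH[OF 2(1)] by blast
    have "x - (2 + y) / 3 = (z - y) / 3" unfolding 2(2) by argo
    then have "\<bar>x - (2 + y) / 3\<bar> = \<bar>z - y\<bar> / 3" by (simp only: abs_divide)
    then have "\<bar>x - (2 + y) / 3\<bar> \<le> 1 / 3 ^ Suc n"
      using divide_right_mono[OF y(3), of 3] by simp
    moreover have "(2 + y) / 3 \<noteq> x" using y(2) 2(2) by simp
    ultimately show ?thesis using cantor_set_thirds(2)[OF y(1)] by blast
  qed
qed

text \<open>Points in different thirds are separated by 1/2. Points in the same third are blown up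
  by 3, which lowers \<open>n\<close>, until a distance above 1 is impossible. Rationality of
  \<open>q\<close> keeps the family of cuts countable.\<close>

lemma cantor_set_gap:
  assumes "x \<in> cantor_set" "y \<in> cantor_set" "1 / 3 ^ n < y - x"
  shows "\<exists>q\<in>\<rat>. q \<notin> cantor_set \<and> x < q \<and> q < y"
  using assms
proof (induction n arbitrary: x y)
  case 0
  then show ?case using subsetD[OF cantor_set_subset, of x] subsetD[OF cantor_set_subset, of y] by simp
next
  case (Suc n)
  have pos: "(0::real) < 1 / 3 ^ Suc n" by simp
  have bd: "0 \<le> u" "u \<le> 1" if "u \<in> cantor_set" for u
    using subsetD[OF cantor_set_subset that] by simp_all
  show ?case using Suc.prems(1)
  proof (cases rule: cantor_set_cases)
    case x: (1 u)
    show ?thesis using Suc.prems(2)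
    proof (cases rule: cantor_set_cases)
      case y: (1 v)
      have "1 / 3 ^ n < v - u" using Suc.prems(3) x y by (simp add: field_simps)
      from Suc.IH[OF x(1) y(1) this] obtain q where q: "q \<in> \<rat>" "q \<notin> cantor_set" "u < q" "q < v" by blast
      have "q / 3 \<notin> cantor_set"
      proof
        assume "q / 3 \<in> cantor_set"
        then show False using q bd[OF y(1)] bd by (cases rule: cantor_set_cases) force+
      qed
      then show ?thesis using q x y by (intro bexI[of _ "q / 3"]) auto
    next
      case y: (2 v)
      have "1 / 2 \<notin> cantor_set"
      proof
        assume "1 / 2 \<in> cantor_set"
        then show False using bd by (cases rule: cantor_set_cases) force+
      qed
      then show ?thesis using x y bd[OF x(1)] bd[OF y(1)] by (intro bexI[of _ "1 / 2"]) auto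
    qed
  next
    case x: (2 u)
    show ?thesis using Suc.prems(2)
    proof (cases rule: cantor_set_cases)
      case y: (1 v)
      then show ?thesis using Suc.prems(3) pos x bd[OF x(1)] bd[OF y(1)] by argo
    next
      case y: (2 v)
      have "1 / 3 ^ n < v - u" using Suc.prems(3) x y by (simp add: field_simps)
      from Suc.IH[OF x(1) y(1) this] obtain q where q: "q \<in> \<rat>" "q \<notin> cantor_set" "u < q" "q < v" by blast
      have "(2 + q) / 3 \<notin> cantor_set"
      proof
        assume "(2 + q) / 3 \<in> cantor_set"
        then show False using q bd[OF x(1)] bd by (cases rule: cantor_set_cases) force+
      qed
      then show ?thesis using q x y by (intro bexI[of _ "(2 + q) / 3"]) auto
    qed
  qed
qed

lemma cantor_set_homeomorphic_cube:
  "subtopology euclideanreal cantor_set homeomorphic_space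
     product_topology (\<lambda>_::nat. discrete_topology (UNIV :: bool set)) UNIV"
proof (rule homeomorphic_Cantor_cube)
  \<comment> \<open>Cutting at a point outside the set gives the same piece with \<open><\<close>
    and with \<open>\<le>\<close>, hence a clopen one.\<close>
  let ?\<B> = "(\<lambda>q. cantor_set \<inter> {..<q}) ` (\<rat> - cantor_set)"
  have pow: "\<exists>n. 1 / 3 ^ n < e" if "0 < e" for e :: real
    using real_arch_pow_inv[OF that, of "1 / 3"] by (auto simp: power_one_over)
  show "compact_space (subtopology euclideanreal cantor_set)"
    using compact_cantor_set by (simp add: compact_space_subtopology)
  show "topspace (subtopology euclideanreal cantor_set) \<noteq> {}" using cantor_set_0_1 by auto
  show "countable ?\<B>" using countable_rat by (intro countable_image countable_Diff)
  show "openin (subtopology euclideanreal cantor_set) B" if "B \<in> ?\<B>" for B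
    using that by (auto intro: openin_open_Int)
  show "closedin (subtopology euclideanreal cantor_set) B" if B: "B \<in> ?\<B>" for B
  proof -
    obtain q where q: "q \<notin> cantor_set" "B = cantor_set \<inter> {..<q}" using B by blast
    then have "B = cantor_set \<inter> {..q}" by (auto simp: less_le)
    then show ?thesis by (auto intro: closedin_closed_Int)
  qed
  show "\<exists>B\<in>?\<B>. x \<in> B \<longleftrightarrow> y \<notin> B"
    if "x \<in> topspace (subtopology euclideanreal cantor_set)"
      "y \<in> topspace (subtopology euclideanreal cantor_set)" "x \<noteq> y" for x y
  proof -
    have xy: "x \<in> cantor_set" "y \<in> cantor_set" using that by auto
    have *: "\<exists>q\<in>\<rat> - cantor_set. u < q \<and> q < v" if "u \<in> cantor_set" "v \<in> cantor_set" "u < v" for u v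
      using pow[of "v - u"] cantor_set_gap[OF that(1,2)] that(3) by auto
    from \<open>x \<noteq> y\<close> consider "x < y" | "y < x" by linarith
    then show ?thesis
    proof cases
      case 1
      then obtain q where "q \<in> \<rat> - cantor_set" "x < q" "q < y" using *[OF xy] by blast
      then show ?thesis using xy by (intro bexI[of _ "cantor_set \<inter> {..<q}"]) auto
    next
      case 2
      then obtain q where "q \<in> \<rat> - cantor_set" "y < q" "q < x" using *[OF xy(2,1)] by blast
      then show ?thesis using xy by (intro bexI[of _ "cantor_set \<inter> {..<q}"]) auto
    qed
  qed
  show "\<exists>y\<in>U. y \<noteq> x" if U: "openin (subtopology euclideanreal cantor_set) U" "x \<in> U" for U x
  proof -
    have x: "x \<in> cantor_set" using openin_subset[OF U(1)] U(2) by auto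
    obtain e where e: "0 < e" "\<And>y. y \<in> cantor_set \<Longrightarrow> dist y x < e \<Longrightarrow> y \<in> U"
      using U unfolding openin_euclidean_subtopology_iff by metis
    obtain n where "1 / 3 ^ n < e" using pow[OF e(1)] by blast
    moreover obtain y where "y \<in> cantor_set" "y \<noteq> x" "\<bar>x - y\<bar> \<le> 1 / 3 ^ n"
      using cantor_set_no_isolated[OF x, of n] by blast
    ultimately show ?thesis using e(2)[of y] by (auto simp: dist_real_def)
  qed
qed

subsection \<open>Gapped spaces\<close>

text \<open>On a nonempty space the last clause forces \<open>b \<le> c\<close>, so the balls of
  radius \<open>b\<close> are smaller than \<open>e\<close>.\<close>

definition gapped :: "real \<Rightarrow> 'a metric \<Rightarrow> bool" where
  "gapped e X \<longleftrightarrow> (\<exists>a b c. 0 \<le> a \<and> 2 * a < b \<and> c < e \<and>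
     (\<forall>x\<in>mspace X. \<forall>y\<in>mspace X. mdist X x y \<le> a \<or> b \<le> mdist X x y) \<and>
     (\<forall>x\<in>mspace X. \<exists>y\<in>mspace X. b \<le> mdist X x y \<and> mdist X x y \<le> c))"

lemma gapped_stable:
  assumes "gapped e X"
  obtains h where "0 < h" "\<And>(Y :: 'b metric) h' R. correspondence X Y h' R \<Longrightarrow> h' \<le> h \<Longrightarrow> gapped e Y"
proof -
  obtain a b c where abc: "0 \<le> a" "2 * a < b" "c < e"
    and gap: "\<And>x y. x \<in> mspace X \<Longrightarrow> y \<in> mspace X \<Longrightarrow> mdist X x y \<le> a \<or> b \<le> mdist X x y"
    and near: "\<And>x. x \<in> mspace X \<Longrightarrow> \<exists>y\<in>mspace X. b \<le> mdist X x y \<and> mdist X x y \<le> c"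
    using assms unfolding gapped_def by blast
  \<comment> \<open>The perturbed witnesses are \<open>a + h\<close>, \<open>b - h\<close>,
    \<open>c + h\<close>. They need \<open>3 * h < b - 2 * a\<close> and \<open>h < e - c\<close>; a
    quarter and a half keep both strict.\<close>
  define h where "h = min ((b - 2 * a) / 4) ((e - c) / 2)"
  have h: "0 < h" "4 * h \<le> b - 2 * a" "2 * h \<le> e - c"
    using abc by (auto simp: h_def min_def field_simps)
  have "gapped e Y" if R: "correspondence X Y h' R" and "h' \<le> h" for Y :: "'b metric" and h' R
    unfolding gapped_def
  proof (intro exI conjI ballI)
    have dist: "\<bar>mdist X x x' - mdist Y y y'\<bar> \<le> h" if "(x, y) \<in> R" "(x', y') \<in> R" for x x' y y'
      using correspondence_distortion[OF R that] \<open>h' \<le> h\<close> by linarith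
    show "0 \<le> a + h" using abc h by linarith
    show "2 * (a + h) < b - h" using h by argo
    show "c + h < e" using abc h by linarith
    fix y assume y: "y \<in> mspace Y"
    then obtain x where x: "(x, y) \<in> R" using correspondence_obtain(2)[OF R] by blast
    have xX: "x \<in> mspace X" using correspondence_mem[OF R x] by simp
    show "mdist Y y y' \<le> a + h \<or> b - h \<le> mdist Y y y'" if "y' \<in> mspace Y" for y'
    proof -
      obtain x' where x': "(x', y') \<in> R" using correspondence_obtain(2)[OF R \<open>y' \<in> mspace Y\<close>] by blast
      have "x' \<in> mspace X" using correspondence_mem[OF R x'] by simp
      from gap[OF xX this] dist[OF x x'] show ?thesis by linarith
    qed
    obtain x' where x': "x' \<in> mspace X" "b \<le> mdist X x x'" "mdist X x x' \<le> c"
      using near[OF xX] by blast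
    obtain y' where y': "(x', y') \<in> R" using correspondence_obtain(1)[OF R x'(1)] by blast
    show "\<exists>y'\<in>mspace Y. b - h \<le> mdist Y y y' \<and> mdist Y y y' \<le> c + h"
    proof (rule bexI)
      show "b - h \<le> mdist Y y y' \<and> mdist Y y y' \<le> c + h" using dist[OF x y'] x' by linarith
      show "y' \<in> mspace Y" using correspondence_mem[OF R y'] by simp
    qed
  qed
  then show thesis using that h(1) by blast
qed

lemma compact_metric_finite_net:
  assumes "compact_metric X" "0 < e"
  obtains K where "finite K" "K \<subseteq> mspace X" "\<And>x. x \<in> mspace X \<Longrightarrow> \<exists>k\<in>K. mdist X k x < e"
proof -
  interpret Metric_space "mspace X" "mdist X" by simp
  have "compactin mtopology (mspace X)"
    using assms(1) by (simp add: compact_metric_def mtopology_of_def compact_space_def)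
  then have "mtotally_bounded (mspace X)" by (rule compactin_imp_mtotally_bounded)
  then have "\<exists>K. finite K \<and> K \<subseteq> mspace X \<and> mspace X \<subseteq> (\<Union>x\<in>K. mball x e)"
    using assms(2) by (simp add: mtotally_bounded_def)
  then obtain K where K: "finite K" "K \<subseteq> mspace X" "mspace X \<subseteq> (\<Union>x\<in>K. mball x e)"
    by blast
  show thesis
  proof
    show "\<exists>k\<in>K. mdist X k x < e" if "x \<in> mspace X" for x
      using subsetD[OF K(3) that] by auto
  qed (use K in auto)
qed

text \<open>A finite space has a gap below its least positive distance, but its points may be far
  apart; a twin at distance \<open>t\<close> gives each a close neighbour.\<close>

lemma gapped_dense:
  fixes X :: "'a metric"
  assumes X: "compact_metric X" and "0 < e" "0 < r"
  obtains Y :: "('a \<times> real) metric" and R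
  where "compact_metric Y" "gapped e Y" "correspondence X Y r R"
proof -
  obtain K where K: "finite K" "K \<subseteq> mspace X" "\<And>x. x \<in> mspace X \<Longrightarrow> \<exists>k\<in>K. mdist X k x < r / 4"
    using compact_metric_finite_net[OF X, of "r / 4"] \<open>0 < r\<close> by auto
  \<comment> \<open>The distortion is at most two net errors below \<open>r / 4\<close> plus
    \<open>t\<close>; the bound \<open>e / 2\<close> leaves \<open>t < e\<close>.\<close>
  define t where "t = min (r / 4) (e / 2)"
  have t: "0 < t" "t \<le> r / 4" "t < e" using assms(2,3) by (auto simp: t_def)
  define Y where "Y = submetric (prod_metric X euclidean_metric) (K \<times> {0, t})"
  have mY: "mspace Y = K \<times> {0, t}" using K(2) by (auto simp: Y_def)
  have dY: "mdist Y (x, u) (y, v) = sqrt ((mdist X x y)\<^sup>2 + (u - v)\<^sup>2)" for x y u v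
    by (simp add: Y_def prod_dist_def dist_real_def)
  have K_ne: "K \<noteq> {}" using X K(3) by (fastforce simp: compact_metric_def)
  have "compactin (mtopology_of Y) (mspace Y)"
    using K(1) by (intro finite_imp_compactin) (auto simp: mY)
  then have cY: "compact_metric Y"
    using K_ne by (simp add: compact_metric_def compact_space_def mY)
  define D where "D = {mdist Y p q | p q. p \<in> mspace Y \<and> q \<in> mspace Y \<and> p \<noteq> q}"
  have "D \<subseteq> (\<lambda>(p, q). mdist Y p q) ` (mspace Y \<times> mspace Y)" by (auto simp: D_def)
  then have finD: "finite D" using K(1) by (auto simp: mY intro: finite_subset)
  have twin: "\<exists>q\<in>mspace Y. mdist Y p q = t \<and> q \<noteq> p" if mem: "p \<in> mspace Y" for p
  proof -
    obtain k u where p: "p = (k, u)" "k \<in> K" "u \<in> {0, t}" using mem by (auto simp: mY)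
    have "mdist X k k = 0" using p(2) K(2) by (auto intro: mdist_self)
    \<comment> \<open>\<open>t - u\<close> exchanges the levels 0 and \<open>t\<close>.\<close>
    then have "mdist Y p (k, t - u) = t" using p(3) t(1) by (auto simp: p(1) dY)
    then show ?thesis using p t(1) by (intro bexI[of _ "(k, t - u)"]) (auto simp: mY)
  qed
  obtain p0 where "p0 \<in> mspace Y" using K_ne by (auto simp: mY)
  have tD: "t \<in> D" using twin[OF \<open>p0 \<in> mspace Y\<close>] \<open>p0 \<in> mspace Y\<close> unfolding D_def by blast
  \<comment> \<open>Unification finds the witnesses \<open>a = 0\<close>, \<open>b = Min D\<close>,
    \<open>c = t\<close>.\<close>
  have "gapped e Y"
    unfolding gapped_def
  proof (intro exI conjI ballI)
    have "Min D \<in> D" using finD tD by (intro Min_in) auto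
    then obtain p q where "Min D = mdist Y p q" "p \<in> mspace Y" "q \<in> mspace Y" "p \<noteq> q"
      by (auto simp: D_def)
    then show "2 * 0 < Min D" using mdist_nonneg[of Y p q] by (simp add: less_le)
    show "mdist Y p q \<le> 0 \<or> Min D \<le> mdist Y p q" if "p \<in> mspace Y" "q \<in> mspace Y" for p q
    proof (cases "p = q")
      case True
      then show ?thesis using mdist_self[OF that(1)] by simp
    next
      case False
      then have "mdist Y p q \<in> D" using that unfolding D_def by blast
      then show ?thesis using Min_le[OF finD] by blast
    qed
    show "\<exists>q\<in>mspace Y. Min D \<le> mdist Y p q \<and> mdist Y p q \<le> t" if "p \<in> mspace Y" for p
      using twin[OF that] Min_le[OF finD tD] by auto
  qed (use t in auto)
  define R where "R = {(x, p). x \<in> mspace X \<and> p \<in> mspace Y \<and> mdist X (fst p) x < r / 4}"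
  have "correspondence X Y r R"
    unfolding correspondence_def
  proof (intro conjI)
    show "R \<subseteq> mspace X \<times> mspace Y" by (auto simp: R_def)
    show "\<forall>x\<in>mspace X. \<exists>p. (x, p) \<in> R"
    proof
      fix x assume x: "x \<in> mspace X"
      then obtain k where "k \<in> K" "mdist X k x < r / 4" using K(3) by blast
      then have "(x, (k, 0)) \<in> R" using x by (simp add: R_def mY)
      then show "\<exists>p. (x, p) \<in> R" by blast
    qed
    show "\<forall>p\<in>mspace Y. \<exists>x. (x, p) \<in> R"
    proof
      fix p assume p: "p \<in> mspace Y"
      then have "fst p \<in> mspace X" using K(2) by (auto simp: mY)
      then have "(fst p, p) \<in> R" using p \<open>0 < r\<close> by (simp add: R_def mdist_self)
      then show "\<exists>x. (x, p) \<in> R" by blast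
    qed
    show "\<forall>(x, p)\<in>R. \<forall>(x', p')\<in>R. \<bar>mdist X x x' - mdist Y p p'\<bar> \<le> r"
    proof clarify
      fix x k u x' k' u' assume R: "(x, (k, u)) \<in> R" "(x', (k', u')) \<in> R"
      then have x: "x \<in> mspace X" "x' \<in> mspace X" and k: "k \<in> mspace X" "k' \<in> mspace X"
        and less: "mdist X k x < r / 4" "mdist X k' x' < r / 4" and u: "u \<in> {0, t}" "u' \<in> {0, t}"
        using K(2) by (auto simp: R_def mY)
      have "mdist X k k' \<le> mdist Y (k, u) (k', u')" by (simp add: dY)
      moreover have "mdist Y (k, u) (k', u') \<le> mdist X k k' + \<bar>u - u'\<bar>"
        using sqrt_sum_squares_le_sum_abs[of "mdist X k k'" "u - u'"] by (simp add: dY)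
      moreover have "\<bar>u - u'\<bar> \<le> t" using u t(1) by auto
      moreover have "mdist X x x' \<le> mdist X k x + mdist X k k' + mdist X k' x'"
        using mdist_triangle[of x X k x'] mdist_triangle[of k X k' x'] x k mdist_commute[of X x k] by linarith
      moreover have "mdist X k k' \<le> mdist X k x + mdist X x x' + mdist X k' x'"
        using mdist_triangle[of k X x k'] mdist_triangle[of x X x' k'] x k mdist_commute[of X x' k'] by linarith
      ultimately show "\<bar>mdist X x x' - mdist Y (k, u) (k', u')\<bar> \<le> r"
        using less t(2) by linarith
    qed
  qed
  with cY \<open>gapped e Y\<close> show thesis by (rule that)
qed

lemma gapped_homeomorphic_cantor_set:
  assumes X: "compact_metric X" and gapped: "\<And>n. gapped (1 / Suc n) X"
  shows "mtopology_of X homeomorphic_space subtopology euclideanreal cantor_set"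
proof -
  interpret Metric_space "mspace X" "mdist X" by simp
  have top: "mtopology_of X = mtopology" by (simp add: mtopology_of_def)
  obtain a b c where abc: "\<And>n. 0 \<le> a n" "\<And>n. 2 * a n < b n" "\<And>n::nat. c n < 1 / Suc n"
    and gap: "\<And>n x y. x \<in> mspace X \<Longrightarrow> y \<in> mspace X \<Longrightarrow> mdist X x y \<le> a n \<or> b n \<le> mdist X x y"
    and near: "\<And>n x. x \<in> mspace X \<Longrightarrow> \<exists>y\<in>mspace X. b n \<le> mdist X x y \<and> mdist X x y \<le> c n"
    using gapped unfolding gapped_def by metis
  have b_pos: "0 < b n" for n using abc(1,2)[of n] by linarith
  obtain K where K: "\<And>n. finite (K n)" "\<And>n. K n \<subseteq> mspace X"
    "\<And>n x. x \<in> mspace X \<Longrightarrow> \<exists>k\<in>K n. mdist X k x < b n"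
  proof -
    have "\<exists>K. finite K \<and> K \<subseteq> mspace X \<and> (\<forall>x\<in>mspace X. \<exists>k\<in>K. mdist X k x < b n)" for n
      using compact_metric_finite_net[OF X b_pos[of n]] by metis
    then show thesis using that by metis
  qed
  have small: "\<exists>n. 1 / real (Suc n) < e" if "0 < e" for e
    using nat_approx_posE[OF that] by blast
  \<comment> \<open>Distances below \<open>b n\<close> are at most \<open>a n\<close>, so this is
    the transitivity that makes the balls of radius \<open>b n\<close> a partition.\<close>
  have near': "mdist X y z < b n"
    if "x \<in> mspace X" "y \<in> mspace X" "z \<in> mspace X" "mdist X x y < b n" "mdist X x z < b n" for n x y z
    using gap[OF that(1,2), of n] gap[OF that(1,3), of n] that(4,5) abc(2)[of n]
      triangle[OF that(2,1,3)] commute[of x y] by linarith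
  have "mtopology_of X homeomorphic_space
      product_topology (\<lambda>_::nat. discrete_topology (UNIV :: bool set)) UNIV"
  proof (rule homeomorphic_Cantor_cube)
    show "compact_space (mtopology_of X)" "topspace (mtopology_of X) \<noteq> {}"
      using X by (simp_all add: compact_metric_def)
    \<comment> \<open>The finite nets leave finitely many balls for each \<open>n\<close>, and these
      still cover the space.\<close>
    let ?\<B> = "\<Union>n. (\<lambda>k. mball k (b n)) ` K n"
    show "countable ?\<B>" using K(1) by (intro countable_UN) (auto intro: countable_finite)
    show "openin (mtopology_of X) B" if "B \<in> ?\<B>" for B
      using that by (auto simp: top)
    show "closedin (mtopology_of X) B" if "B \<in> ?\<B>" for B
    proof -
      obtain n k where B: "B = mball k (b n)" using \<open>B \<in> ?\<B>\<close> by blast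
      have "openin mtopology (mspace X - B)"
        unfolding openin_mtopology
      proof (intro conjI allI impI)
        fix x assume x: "x \<in> mspace X - B"
        have "mball x (b n) \<subseteq> mspace X - B"
          using x near'[of _ k x n] by (auto simp: B commute)
        then show "\<exists>r>0. mball x r \<subseteq> mspace X - B" using b_pos by blast
      qed auto
      then show ?thesis by (auto simp: top closedin_def B)
    qed
    show "\<exists>B\<in>?\<B>. x \<in> B \<longleftrightarrow> y \<notin> B"
      if "x \<in> topspace (mtopology_of X)" "y \<in> topspace (mtopology_of X)" "x \<noteq> y" for x y
    proof -
      have xy: "x \<in> mspace X" "y \<in> mspace X" using that by auto
      then obtain n where n: "1 / real (Suc n) < mdist X x y"
        using small[of "mdist X x y"] \<open>x \<noteq> y\<close> by auto
      obtain k where k: "k \<in> K n" "mdist X k x < b n" using K(3)[OF xy(1)] by blast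
      then have "k \<in> mspace X" using K(2) by blast
      \<comment> \<open>Otherwise \<open>x\<close> and \<open>y\<close> would be closer than
        \<open>b n\<close>, which the neighbour of \<open>x\<close> shows to be at most
        \<open>c n\<close> and so below their distance.\<close>
      moreover have "\<not> mdist X k y < b n"
        using near'[OF \<open>k \<in> mspace X\<close> xy k(2)] near[OF xy(1), of n] abc(3)[of n] n by auto
      ultimately show ?thesis using k xy by (intro bexI[of _ "mball k (b n)"]) auto
    qed
    show "\<exists>y\<in>U. y \<noteq> x" if U: "openin (mtopology_of X) U" "x \<in> U" for U x
    proof -
      have x: "x \<in> mspace X" using openin_subset[OF U(1)] U(2) by auto
      obtain r where r: "0 < r" "mball x r \<subseteq> U" using U by (auto simp: top openin_mtopology)
      obtain n where n: "1 / real (Suc n) < r" using small[OF r(1)] by blast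
      obtain y where y: "y \<in> mspace X" "b n \<le> mdist X x y" "mdist X x y \<le> c n"
        using near[OF x] by blast
      have "y \<in> U" using r(2) y x n abc(3)[of n] by (intro subsetD[OF r(2)]) auto
      moreover have "y \<noteq> x" using y(2) b_pos[of n] mdist_self[OF x] by auto
      ultimately show ?thesis by blast
    qed
  qed
  then show ?thesis
    using cantor_set_homeomorphic_cube homeomorphic_space_sym homeomorphic_space_trans by blast
qed

section \<open>Openness, density and Baire category\<close>

lemma topspace_gh_topology: "topspace gh_topology = UNIV"
  using Metric_space.topspace_mtopology[OF Metric_space_gh_dist] by (simp add: gh_topology_def)

lemma openin_gh_gapped: "openin gh_topology {Z. gapped e (rep_gh_space Z)}"
proof -
  interpret Metric_space UNIV gh_dist by (rule Metric_space_gh_dist)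
  show ?thesis
    unfolding gh_topology_def openin_mtopology
  proof (intro conjI allI impI)
    fix Z assume "Z \<in> {Z. gapped e (rep_gh_space Z)}"
    then obtain h where h: "0 < h" "\<And>(Y :: real metric) h' R.
        correspondence (rep_gh_space Z) Y h' R \<Longrightarrow> h' \<le> h \<Longrightarrow> gapped e Y"
      using gapped_stable[of e "rep_gh_space Z"] by blast
    \<comment> \<open>Half of \<open>h\<close>, because distortion is twice the distance.\<close>
    have "gapped e (rep_gh_space W)" if W: "gh_dist Z W < h / 2" for W
    proof -
      obtain R where "correspondence (rep_gh_space Z) (rep_gh_space W) (2 * (h / 2)) R"
        using gh_dist_less_correspondence[OF W] .
      then show ?thesis by (rule h(2)) simp
    qed
    then show "\<exists>r>0. mball Z r \<subseteq> {Z. gapped e (rep_gh_space Z)}"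
      using h(1) by (intro exI[of _ "h / 2"]) auto
  qed simp
qed

text \<open>The model from \<open>gapped_dense\<close> lives on pairs of reals; it is copied to a
  set of reals and then replaced by the representative of its class. \<open>gapped_stable\<close>
  with distortion 0 serves as isometry invariance.\<close>

lemma gh_gapped_dense:
  assumes "0 < e" "0 < r"
  shows "\<exists>W. gapped e (rep_gh_space W) \<and> gh_dist Z W < r"
proof -
  obtain Y :: "(real \<times> real) metric" and R where Y: "compact_metric Y" "gapped e Y"
    and R: "correspondence (rep_gh_space Z) Y r R"
    using gapped_dense[OF compact_metric_rep_gh assms] by blast
  obtain Y' :: "real metric" where Y': "isometric Y Y'" "compact_metric Y'"
    using compact_metric_isometric_real[OF Y(1)] .
  define W where "W = abs_gh_space Y'"
  have "isometric Y (rep_gh_space W)"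
    unfolding W_def by (rule isometric_trans[OF Y'(1) isometric_sym[OF isometric_rep_abs_gh[OF Y'(2)]]])
  then obtain S where S: "correspondence Y (rep_gh_space W) 0 S"
    by (rule correspondence_isometric)
  obtain h where "0 < h" "\<And>(V :: real metric) h' R. correspondence Y V h' R \<Longrightarrow> h' \<le> h \<Longrightarrow> gapped e V"
    using gapped_stable[OF Y(2)] by blast
  then have "gapped e (rep_gh_space W)" using S by (metis less_imp_le)
  moreover have "gh_dist Z W \<le> r / 2"
    using assms(2) by (intro correspondence_gh_dist_le[OF correspondence_relcomp[OF R S]]) auto
  ultimately show ?thesis using assms(2) by (intro exI[of _ W]) auto
qed

lemma rare_in_gh_not_gapped:
  assumes "0 < e" and S: "S \<subseteq> {Z. \<not> gapped e (rep_gh_space Z)}"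
  shows "rare_in gh_topology S"
proof -
  interpret Metric_space UNIV gh_dist by (rule Metric_space_gh_dist)
  have "- {Z. gapped e (rep_gh_space Z)} = {Z. \<not> gapped e (rep_gh_space Z)}" by auto
  then have "closedin gh_topology {Z. \<not> gapped e (rep_gh_space Z)}"
    using openin_gh_gapped[of e] by (metis closedin_def Compl_eq_Diff_UNIV double_complement subset_UNIV topspace_gh_topology)
  then have sub: "gh_topology closure_of S \<subseteq> {Z. \<not> gapped e (rep_gh_space Z)}"
    by (rule closure_of_minimal[OF S])
  have "gh_topology interior_of (gh_topology closure_of S) = {}"
  proof (rule ccontr)
    assume "\<not> ?thesis"
    then obtain Z where "Z \<in> gh_topology interior_of (gh_topology closure_of S)" by blast
    then obtain U where U: "openin gh_topology U" "Z \<in> U" "U \<subseteq> gh_topology closure_of S"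
      by (auto simp: interior_of_def)
    then obtain r where r: "0 < r" "mball Z r \<subseteq> U"
      by (auto simp: gh_topology_def openin_mtopology)
    obtain W where W: "gapped e (rep_gh_space W)" "gh_dist Z W < r"
      using gh_gapped_dense[OF assms(1) r(1)] by blast
    then have "W \<in> mball Z r" by simp
    then show False using W(1) r(2) U(3) sub by blast
  qed
  then show ?thesis by (simp add: rare_in_def topspace_gh_topology)
qed

theorem corollary5:
  shows "residual_in gh_topology
           {X :: gh_space. gh_homeomorphic X (subtopology euclideanreal cantor_set)}"
proof -
  let ?C = "{X :: gh_space. gh_homeomorphic X (subtopology euclideanreal cantor_set)}"
  \<comment> \<open>The union must be exactly the complement of \<open>?C\<close>, yet Cantor spaces
    may fail to be gapped: the middle thirds set realises every distance in [0, 1]. Hence the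
    restriction to \<open>Z \<notin> ?C\<close>.\<close>
  define F where "F n = {Z. Z \<notin> ?C \<and> \<not> gapped (1 / Suc n) (rep_gh_space Z)}" for n
  have "Z \<in> ?C" if "\<And>n. gapped (1 / Suc n) (rep_gh_space Z)" for Z
    using gapped_homeomorphic_cantor_set[OF compact_metric_rep_gh that]
    by (simp add: gh_homeomorphic_def)
  then have "UNIV - ?C = \<Union>(range F)" by (auto simp: F_def)
  moreover have "rare_in gh_topology (F n)" for n
    by (rule rare_in_gh_not_gapped[of "1 / Suc n"]) (auto simp: F_def)
  ultimately have "meager_in gh_topology (UNIV - ?C)"
    unfolding meager_in_def by (intro exI[of _ "range F"]) auto
  then show ?thesis by (simp add: residual_in_def topspace_gh_topology)
qed

end
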